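(* Consider the random walk on $\mathbb{Z}$ with i.i.d. steps equal to $-1,0,1$ with respective probabilities $q,r,p$, $p+q+r=1$, and set $\Delta(u)=(1-ru)^2-4pqu^2$. For $x,y\in(0,1)$ the generating function $K_0$ admits the following expression: (i) if $F=\mathbb{Z}$, $$K_0(x,y)=y\,\frac{(p-q)(x-y)+(1-y)\sqrt{\Delta(x)}+(1-x)\sqrt{\Delta(y)}}{(1-x)(1-y)\big(y-x+y\sqrt{\Delta(x)}+x\sqrt{\Delta(y)}\,\big)};$$ (ii) if $F=\{0\}$, $$K_0(x,y)=\frac{2y}{y-x+y\sqrt{\Delta(x)}+x\sqrt{\Delta(y)}}.$$
   Context: $X_0=0$ and $X_m=\sum_{\ell=1}^mU_\ell$, where $(U_\ell)_{\ell\ge1}$ are i.i.d. with $\mathbb{P}\{U_1=-1\}=q$, $\mathbb{P}\{U_1=0\}=r$, $\mathbb{P}\{U_1=1\}=p$. $\mathbb{P}_0$ denotes probability given $X_0=0$. $T_0=0$ and $T_n=\#\{m\in\{1,\dots,n\}:X_m\ge0\}$ for $n\ge1$. For $F\subset\mathbb{Z}$, $$K_0(x,y)=\sum_{m,n\in\{0,1,2,\dots\}:\,m\le n}\mathbb{P}_0\{T_n=m,\,X_n\in F\}\,x^my^{n-m}.$$ *)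

theory Defs
  imports "HOL-Probability.Probability"
begin

text \<open>The steps \<open>U\<close> are indexed by \<open>1, 2, \<dots>\<close>; the value \<open>U 0\<close> is never used.\<close>

definition walk :: "(nat \<Rightarrow> 'a \<Rightarrow> int) \<Rightarrow> nat \<Rightarrow> 'a \<Rightarrow> int" where
  "walk U m \<omega> = (\<Sum>l=1..m. U l \<omega>)"

definition sojourn :: "(nat \<Rightarrow> 'a \<Rightarrow> int) \<Rightarrow> nat \<Rightarrow> 'a \<Rightarrow> nat" where
  "sojourn U n \<omega> = card {m \<in> {1..n}. walk U m \<omega> \<ge> 0}"

text \<open>
  The walk starts at \<open>0\<close> by construction, so the probability given that it starts at \<open>0\<close>
  is just the measure \<open>M\<close>.  The double series is the unordered sum over all pairs
  \<open>m \<le> n\<close>; its terms are nonnegative whenever \<open>x, y \<ge> 0\<close>.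
\<close>

definition K0 :: "'a measure \<Rightarrow> (nat \<Rightarrow> 'a \<Rightarrow> int) \<Rightarrow> int set \<Rightarrow> real \<Rightarrow> real \<Rightarrow> real" where
  "K0 M U F x y =
     (\<Sum>\<^sub>\<infinity>(m, n)\<in>{(m, n). m \<le> n}.
        measure M {\<omega> \<in> space M. sojourn U n \<omega> = m \<and> walk U n \<omega> \<in> F} * x ^ m * y ^ (n - m))"

definition Delta :: "real \<Rightarrow> real \<Rightarrow> real \<Rightarrow> real \<Rightarrow> real" where
  "Delta p q r u = (1 - r * u)\<^sup>2 - 4 * p * q * u\<^sup>2"

end

theory Submission imports Defs begin

text \<open>
  Let \<open>G(F)\<close> be the sum over \<open>n\<close> of the expectation of \<open>x\<^sup>T y\<^bsup>n-T\<^esup>\<close> on the event that the walk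
  is in \<open>F\<close> at time \<open>n\<close>, where \<open>T\<close> is the sojourn time up to \<open>n\<close>.  Grouping the double series by
  \<open>n\<close> shows that the generating function is \<open>G(F)\<close> (lemma \<open>K0_eq_G\<close>).  Thus \<open>G\<close> is
  the Green measure of a walk that picks up a factor \<open>x\<close> at each step that ends in the nonnegative
  half line and a factor \<open>y\<close> at each step that ends in the negative one.

  When \<open>F\<close> lies on one side of the boundary, this factor is a constant \<open>c\<close>.  Conditioning on the
  last step then gives (lemma \<open>G_rec\<close>)
  \<open>G(F) = [0 \<in> F] + c (p G(F - 1) + r G(F) + q G(F + 1))\<close>.

  Applied to the singletons on one side of \<open>0\<close>, this is a second-order linear recurrence with
  constant coefficients.  Its characteristic equation has discriminant \<open>Delta\<close>, and boundedness of
  \<open>G\<close> selects the root of smaller modulus.  This expresses \<open>q G{1}\<close> and \<open>p G{-1}\<close> by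
  \<open>G{0}\<close> (lemma \<open>bounded_solution_first_step\<close>), and the equation at the origin then determines
  \<open>G{0}\<close>, which is the second formula.

  For the first formula, apply the same identity to the two half lines.  The translates of a half
  line by \<open>1\<close> differ from it by one point, so by finite additivity \<open>(1 - x) G{0..}\<close> and
  \<open>(1 - y) G{..<0}\<close> are linear in \<open>G{0}\<close> and \<open>p G{-1}\<close>; no series over the
  sites has to be summed.
\<close>

section \<open>Bounded solutions of the recurrence on a half line\<close>

text \<open>
  The characteristic polynomial \<open>u b z\<^sup>2 - (1 - r u) z + u a\<close> takes the value \<open>u - 1 < 0\<close> at \<open>z = 1\<close>,
  so for \<open>b > 0\<close> its roots lie on different sides of \<open>1\<close>.  The statement says that the larger one
  exceeds \<open>1\<close>, in a form that makes sense for \<open>b = 0\<close> too.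
\<close>

lemma decay_ratio_less:
  fixes a b r u :: real
  assumes "0 \<le> a" "0 \<le> b" "0 \<le> r" "a + b + r = 1" "0 < u" "u < 1"
  shows "2 * u * b < 1 - r * u + sqrt (Delta a b r u)"
proof (cases "b = 0")
  case True
  have "r * u \<le> u" using assms by (simp add: mult_left_le_one_le)
  moreover have "0 \<le> Delta a b r u" using True by (simp add: Delta_def)
  ultimately show ?thesis using True assms by (smt (verit) mult_eq_0_iff real_sqrt_ge_zero)
next
  case False
  have "Delta a b r u - (2 * u * b - (1 - r * u))\<^sup>2 = 4 * u * b * (1 - r * u - a * u - b * u)"
    by (simp add: Delta_def power2_eq_square algebra_simps)
  also have "1 - r * u - a * u - b * u = 1 - u * (a + b + r)" by (simp add: algebra_simps)
  also have "4 * u * b * (1 - u * (a + b + r)) > 0"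
    using False assms by (simp add: less_le)
  finally have "2 * u * b - (1 - r * u) < sqrt (Delta a b r u)"
    by (intro real_less_rsqrt) simp
  then show ?thesis by simp
qed

lemma Delta_nonneg:
  fixes a b r u :: real
  assumes "0 \<le> a" "0 \<le> b" "0 \<le> r" "a + b + r = 1" "0 < u" "u < 1"
  shows "0 \<le> Delta a b r u"
proof -
  have r: "r = 1 - a - b" using assms by simp
  have "Delta a b r u = ((1 - u) + (a + b) * u)\<^sup>2 - 4 * a * b * u\<^sup>2"
    unfolding Delta_def r by (simp add: algebra_simps)
  also have "\<dots> = (1 - u)\<^sup>2 + 2 * (1 - u) * ((a + b) * u) + ((a - b) * u)\<^sup>2"
    by (simp add: power2_eq_square algebra_simps)
  also have "\<dots> \<ge> 0" using assms by simp
  finally show ?thesis .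
qed

text \<open>
  If \<open>b > 0\<close>, a bounded solution is a multiple of the powers of the smaller root
  \<open>(1 - r u - sqrt (Delta a b r u)) / (2 u b)\<close>, since the other root exceeds \<open>1\<close>.  Clearing the
  denominator keeps the case \<open>b = 0\<close>, in which the recurrence has order one, within the same proof.
\<close>

lemma bounded_solution_first_step:
  fixes a b r u B :: real and g :: "nat \<Rightarrow> real"
  assumes par: "0 \<le> a" "0 \<le> b" "0 \<le> r" "a + b + r = 1" "0 < u" "u < 1"
    and bound: "\<And>k. \<bar>g k\<bar> \<le> B"
    and rec: "\<And>k. (1 - r * u) * g (Suc k) = u * (a * g k + b * g (Suc (Suc k)))"
  shows "2 * u * b * g 1 = (1 - r * u - sqrt (Delta a b r u)) * g 0"
proof -
  define s where "s = sqrt (Delta a b r u)"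
  define c where "c = (1 - r * u + s) / 2"
  define d where "d = (1 - r * u - s) / 2"
  have s2: "s\<^sup>2 = Delta a b r u" using Delta_nonneg[OF par] by (simp add: s_def)
  have s0: "s \<ge> 0" using Delta_nonneg[OF par] by (simp add: s_def)
  have cd: "c * d = u\<^sup>2 * a * b"
  proof -
    have "4 * (c * d) = (1 - r * u + s) * (1 - r * u - s)" by (simp add: c_def d_def)
    also have "\<dots> = (1 - r * u)\<^sup>2 - s\<^sup>2" by (simp add: power2_eq_square algebra_simps)
    finally have "4 * (c * d) = (1 - r * u)\<^sup>2 - s\<^sup>2" .
    then show ?thesis unfolding s2 Delta_def by simp
  qed
  have cpd: "c + d = 1 - r * u" by (simp add: c_def d_def field_simps)
  have ub: "u * b < c" using decay_ratio_less[OF par] by (simp add: c_def s_def)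
  have ub0: "0 \<le> u * b" using par by simp
  have c0: "0 < c" using ub ub0 by simp
  \<comment> \<open>As \<open>c\<close> and \<open>d\<close> are \<open>u b\<close> times the larger and the smaller root, and the product of the roots
    is \<open>a / b\<close>, the smaller root is also \<open>u a / c\<close>.  Hence \<open>D\<close> vanishes on the decaying
    solution; splitting this root off leaves a first-order recurrence whose solutions grow by the
    larger root.\<close>
  define D where "D k = c * g (Suc k) - u * a * g k" for k
  have step: "c * D k = u * b * D (Suc k)" for k
  proof -
    have "u * b * D (Suc k) = c * (u * b * g (Suc (Suc k))) - (u\<^sup>2 * a * b) * g (Suc k)"
      by (simp add: D_def power2_eq_square algebra_simps)
    also have "u * b * g (Suc (Suc k)) = (c + d) * g (Suc k) - u * a * g k"
      using rec[of k] by (simp add: cpd algebra_simps)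
    also have "c * ((c + d) * g (Suc k) - u * a * g k) - (u\<^sup>2 * a * b) * g (Suc k) = c * D k"
      unfolding cd[symmetric] by (simp add: D_def algebra_simps)
    finally show ?thesis by simp
  qed
  define \<rho> where "\<rho> = u * b / c"
  have \<rho>: "0 \<le> \<rho>" "\<rho> < 1" using ub ub0 c0 by (simp_all add: \<rho>_def)
  have D0: "D 0 = \<rho> ^ k * D k" for k
  proof (induction k)
    case (Suc k)
    have "D k = \<rho> * D (Suc k)" using step[of k] c0 by (simp add: \<rho>_def field_simps)
    with Suc show ?case by simp
  qed simp
  have bD: "\<bar>D k\<bar> \<le> (c + u * a) * B" for k
  proof -
    have "\<bar>D k\<bar> \<le> \<bar>c * g (Suc k)\<bar> + \<bar>u * a * g k\<bar>" unfolding D_def by (rule abs_triangle_ineq4)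
    also have "\<dots> = c * \<bar>g (Suc k)\<bar> + u * a * \<bar>g k\<bar>" using c0 par by (simp add: abs_mult)
    also have "\<dots> \<le> c * B + u * a * B"
      using c0 par bound by (intro add_mono mult_left_mono) auto
    finally show ?thesis by (simp add: algebra_simps)
  qed
  have "(\<lambda>k. \<rho> ^ k * ((c + u * a) * B)) \<longlonglongrightarrow> 0"
    using \<rho> by (intro tendsto_mult_left_zero LIMSEQ_realpow_zero) auto
  moreover have "\<bar>D 0\<bar> \<le> \<rho> ^ k * ((c + u * a) * B)" for k
    using bD[of k] \<rho> by (subst D0[of k]) (simp add: abs_mult mult_left_mono)
  ultimately have "\<bar>D 0\<bar> \<le> 0" by (intro LIMSEQ_le_const) auto
  then have eq: "c * g 1 = u * a * g 0" by (simp add: D_def)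
  have "c * (u * b * g 1) = u * b * (c * g 1)" by simp
  also have "\<dots> = (u\<^sup>2 * a * b) * g 0" unfolding eq by (simp add: power2_eq_square)
  also have "\<dots> = c * (d * g 0)" unfolding cd[symmetric] by simp
  finally have "u * b * g 1 = d * g 0" using c0 by simp
  then show ?thesis by (simp add: d_def s_def field_simps)
qed

section \<open>The walk and its sojourn weight\<close>

definition sojourn_weight :: "(nat \<Rightarrow> 'a \<Rightarrow> int) \<Rightarrow> real \<Rightarrow> real \<Rightarrow> nat \<Rightarrow> 'a \<Rightarrow> real" where
  "sojourn_weight U x y n \<omega> = x ^ sojourn U n \<omega> * y ^ (n - sojourn U n \<omega>)"

text \<open>The factor that the weight gains at a step that ends in \<open>k\<close>.\<close>

definition site_weight :: "real \<Rightarrow> real \<Rightarrow> int \<Rightarrow> real" where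
  "site_weight x y k = (if k \<ge> 0 then x else y)"

lemma walk_0 [simp]: "walk U 0 \<omega> = 0"
  by (simp add: walk_def)

lemma walk_Suc: "walk U (Suc n) \<omega> = walk U n \<omega> + U (Suc n) \<omega>"
  by (simp add: walk_def)

lemma sojourn_0 [simp]: "sojourn U 0 \<omega> = 0"
  by (simp add: sojourn_def)

lemma sojourn_le: "sojourn U n \<omega> \<le> n"
proof -
  have "sojourn U n \<omega> \<le> card {1..n}" unfolding sojourn_def by (intro card_mono) auto
  then show ?thesis by simp
qed

lemma sojourn_Suc:
  "sojourn U (Suc n) \<omega> = sojourn U n \<omega> + of_bool (walk U (Suc n) \<omega> \<ge> 0)"
proof -
  have "{m \<in> {1..Suc n}. walk U m \<omega> \<ge> 0} =
      {m \<in> {1..n}. walk U m \<omega> \<ge> 0} \<union> (if walk U (Suc n) \<omega> \<ge> 0 then {Suc n} else {})"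
    by (auto simp: le_Suc_eq)
  then show ?thesis by (simp add: sojourn_def)
qed

lemma sojourn_weight_0 [simp]: "sojourn_weight U x y 0 \<omega> = 1"
  by (simp add: sojourn_weight_def)

lemma sojourn_weight_Suc:
  "sojourn_weight U x y (Suc n) \<omega> =
     sojourn_weight U x y n \<omega> * site_weight x y (walk U (Suc n) \<omega>)"
  using sojourn_le[of U n \<omega>]
  by (auto simp: sojourn_weight_def site_weight_def sojourn_Suc Suc_diff_le)

lemma sojourn_weight_bounds:
  assumes "0 < x" "0 < y"
  shows "0 \<le> sojourn_weight U x y n \<omega>" "sojourn_weight U x y n \<omega> \<le> max x y ^ n"
proof -
  show "0 \<le> sojourn_weight U x y n \<omega>" using assms by (simp add: sojourn_weight_def)
  have "sojourn_weight U x y n \<omega> \<le> max x y ^ sojourn U n \<omega> * max x y ^ (n - sojourn U n \<omega>)"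
    unfolding sojourn_weight_def using assms by (intro mult_mono power_mono) auto
  also have "\<dots> = max x y ^ n" using sojourn_le[of U n \<omega>] by (simp flip: power_add)
  finally show "sojourn_weight U x y n \<omega> \<le> max x y ^ n" .
qed

lemma sojourn_weight_expand:
  "sojourn_weight U x y n \<omega> * indicator F (walk U n \<omega>) =
     (\<Sum>m\<le>n. indicator {\<omega>. sojourn U n \<omega> = m \<and> walk U n \<omega> \<in> F} \<omega> * (x ^ m * y ^ (n - m)))"
proof -
  have "(\<Sum>m\<le>n. indicator {\<omega>. sojourn U n \<omega> = m \<and> walk U n \<omega> \<in> F} \<omega> * (x ^ m * y ^ (n - m))) =
      (\<Sum>m\<le>n. if sojourn U n \<omega> = m then indicator F (walk U n \<omega>) * (x ^ m * y ^ (n - m)) else 0)"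
    by (intro sum.cong) (auto simp: indicator_def)
  then show ?thesis using sojourn_le[of U n \<omega>] by (simp add: sojourn_weight_def)
qed

text \<open>
  The next two lemmas write the walk and its sojourn time as functions on path space applied to the
  restricted family of steps; that is the form in which independence of the past and the next step
  is available.
\<close>

lemma walk_path: "walk U n \<omega> = walk (\<lambda>l f. f l) n (\<lambda>l\<in>{1..n}. U l \<omega>)"
  by (simp add: walk_def)

lemma sojourn_path: "sojourn U n \<omega> = sojourn (\<lambda>l f. f l) n (\<lambda>l\<in>{1..n}. U l \<omega>)"
proof -
  have "walk U m \<omega> = walk (\<lambda>l f. f l) m (\<lambda>l\<in>{1..n}. U l \<omega>)" if "m \<le> n" for m
    unfolding walk_def using that by (intro sum.cong) auto
  then show ?thesis unfolding sojourn_def by (intro arg_cong[where f=card]) auto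
qed

lemma measurable_walk:
  fixes V :: "nat \<Rightarrow> 'b \<Rightarrow> int"
  assumes "\<And>l. l \<in> {1..n} \<Longrightarrow> V l \<in> measurable N (count_space UNIV)"
  shows "walk V n \<in> measurable N (count_space UNIV)"
  using assms
proof (induction n)
  case 0
  then show ?case by (simp add: walk_def[abs_def])
next
  case (Suc n)
  then have [measurable]: "walk V n \<in> measurable N (count_space UNIV)"
    "V (Suc n) \<in> measurable N (count_space UNIV)" by auto
  show ?case unfolding walk_Suc[abs_def] by measurable
qed

lemma measurable_sojourn:
  fixes V :: "nat \<Rightarrow> 'b \<Rightarrow> int"
  assumes "\<And>l. l \<in> {1..n} \<Longrightarrow> V l \<in> measurable N (count_space UNIV)"
  shows "sojourn V n \<in> measurable N (count_space UNIV)"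
proof -
  have [measurable]: "walk V l \<in> measurable N (count_space UNIV)" if "l \<in> {1..n}" for l
    using assms that by (intro measurable_walk) auto
  show ?thesis unfolding sojourn_def[abs_def] by measurable
qed

lemma measurable_weighted_walk:
  fixes V :: "nat \<Rightarrow> 'b \<Rightarrow> int"
  assumes "\<And>l. l \<in> {1..n} \<Longrightarrow> V l \<in> measurable N (count_space UNIV)"
  shows "(\<lambda>\<omega>. sojourn_weight V x y n \<omega> * indicator F (walk V n \<omega>)) \<in> borel_measurable N"
proof -
  note [measurable] = measurable_walk[OF assms] measurable_sojourn[OF assms]
  show ?thesis unfolding sojourn_weight_def by measurable
qed

section \<open>Expected weights and conditioning on the last step\<close>

locale nearest_neighbour_walk = prob_space M for M :: "'a measure" +
  fixes U :: "nat \<Rightarrow> 'a \<Rightarrow> int" and p q r x y :: real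
  assumes indep: "indep_vars (\<lambda>_. count_space UNIV) U {1..}"
    and prob_down: "\<And>l. l \<ge> 1 \<Longrightarrow> prob {\<omega> \<in> space M. U l \<omega> = -1} = q"
    and prob_stay: "\<And>l. l \<ge> 1 \<Longrightarrow> prob {\<omega> \<in> space M. U l \<omega> = 0} = r"
    and prob_up: "\<And>l. l \<ge> 1 \<Longrightarrow> prob {\<omega> \<in> space M. U l \<omega> = 1} = p"
    and total: "p + q + r = 1"
    and x: "0 < x" "x < 1" and y: "0 < y" "y < 1"
begin

lemma pqr_nonneg: "0 \<le> p" "0 \<le> q" "0 \<le> r"
  using prob_up[of 1] prob_down[of 1] prob_stay[of 1] by auto

lemma measurable_step: "l \<ge> 1 \<Longrightarrow> U l \<in> measurable M (count_space UNIV)"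
  using indep by (auto simp: indep_vars_def)

lemma AE_step: "AE \<omega> in M. U (Suc n) \<omega> \<in> {-1, 0, 1}"
proof -
  have [measurable]: "U (Suc n) \<in> measurable M (count_space UNIV)" by (simp add: measurable_step)
  let ?S = "\<lambda>j. {\<omega> \<in> space M. U (Suc n) \<omega> = j}"
  have "prob (\<Union>j\<in>{-1, 0, 1}. ?S j) = (\<Sum>j\<in>{-1, 0, 1}. prob (?S j))"
    by (intro finite_measure_finite_Union) (auto simp: disjoint_family_on_def)
  also have "\<dots> = 1" using prob_down[of "Suc n"] prob_stay[of "Suc n"] prob_up[of "Suc n"] total by simp
  finally have "AE \<omega> in M. \<omega> \<in> (\<Union>j\<in>{-1, 0, 1}. ?S j)" by (rule AE_prob_1)
  then show ?thesis by eventually_elim auto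
qed

text \<open>
  Both \<open>W n\<close> and the Green measure \<open>G\<close> take sets of sites as arguments, not just sites, because the
  recurrence will be used for singletons and for half lines.
\<close>

definition W :: "nat \<Rightarrow> int set \<Rightarrow> real" where
  "W n F = expectation (\<lambda>\<omega>. sojourn_weight U x y n \<omega> * indicator F (walk U n \<omega>))"

definition G :: "int set \<Rightarrow> real" where
  "G F = (\<Sum>n. W n F)"

lemma integrable_weighted:
  assumes "h \<in> borel_measurable M" "\<And>\<omega>. \<bar>h \<omega>\<bar> \<le> 1"
  shows "integrable M (\<lambda>\<omega>. sojourn_weight U x y n \<omega> * indicator F (walk U n \<omega>) * h \<omega> :: real)"
proof (rule integrable_const_bound[where B = "max x y ^ n"])
  have "\<bar>sojourn_weight U x y n \<omega> * indicator F (walk U n \<omega>) * h \<omega>\<bar> \<le> max x y ^ n" for \<omega>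
  proof -
    have "\<bar>sojourn_weight U x y n \<omega> * (indicator F (walk U n \<omega>) * h \<omega>)\<bar> \<le> max x y ^ n * 1"
      unfolding abs_mult[of "sojourn_weight U x y n \<omega>"]
      using sojourn_weight_bounds[OF x(1) y(1), of U n \<omega>] assms(2)[of \<omega>] x y
      by (intro mult_mono) (auto simp: indicator_def)
    then show ?thesis by (simp add: mult.assoc)
  qed
  then show "AE \<omega> in M. norm (sojourn_weight U x y n \<omega> * indicator F (walk U n \<omega>) * h \<omega>) \<le> max x y ^ n"
    by simp
  show "(\<lambda>\<omega>. sojourn_weight U x y n \<omega> * indicator F (walk U n \<omega>) * h \<omega>) \<in> borel_measurable M"
    using assms(1) measurable_step by (intro borel_measurable_times measurable_weighted_walk) auto
qed

lemma integrable_weighted_walk: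
  "integrable M (\<lambda>\<omega>. sojourn_weight U x y n \<omega> * indicator F (walk U n \<omega>))"
  using integrable_weighted[of "\<lambda>_. 1"] by simp

lemma W_nonneg: "0 \<le> W n F"
  unfolding W_def using sojourn_weight_bounds(1)[OF x(1) y(1)]
  by (intro Bochner_Integration.integral_nonneg mult_nonneg_nonneg) auto

lemma W_le: "W n F \<le> max x y ^ n"
proof -
  have "W n F \<le> expectation (\<lambda>_. max x y ^ n)"
    unfolding W_def using sojourn_weight_bounds[OF x(1) y(1), of U n] x
    by (intro integral_mono integrable_weighted_walk) (auto simp: indicator_def)
  then show ?thesis by (simp add: prob_space)
qed

lemma W_0: "W 0 F = indicator F 0"
  by (simp add: W_def prob_space)

lemma W_Un: "A \<inter> B = {} \<Longrightarrow> W n (A \<union> B) = W n A + W n B"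
  unfolding W_def
  by (subst Bochner_Integration.integral_add[OF integrable_weighted_walk integrable_weighted_walk, symmetric])
     (auto intro!: Bochner_Integration.integral_cong simp: indicator_def)

lemma W_mono: "A \<subseteq> B \<Longrightarrow> W n A \<le> W n B"
  using W_Un[of A "B - A" n] W_nonneg[of n "B - A"] by (simp add: Un_absorb1)

lemma expectation_times_step:
  "expectation (\<lambda>\<omega>. sojourn_weight U x y n \<omega> * indicator F (walk U n \<omega>) * indicator {j} (U (Suc n) \<omega>)) =
     W n F * prob {\<omega> \<in> space M. U (Suc n) \<omega> = j}"
proof -
  have [measurable]: "U (Suc n) \<in> measurable M (count_space UNIV)" by (simp add: measurable_step)
  define h :: "(nat \<Rightarrow> int) \<Rightarrow> real" where
    "h f = sojourn_weight (\<lambda>l f. f l) x y n f * indicator F (walk (\<lambda>l f. f l) n f)" for f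
  have h: "h \<in> borel_measurable (PiM {1..n} (\<lambda>_. count_space UNIV))"
    unfolding h_def by (intro measurable_weighted_walk measurable_component_singleton) auto
  have k: "(\<lambda>f. indicator {j} (f (Suc n)) :: real) \<in> borel_measurable (PiM {Suc n} (\<lambda>_. count_space UNIV))"
    by (rule measurable_compose[OF measurable_component_singleton[of "Suc n"]]) auto
  have "indep_var borel (h \<circ> (\<lambda>\<omega>. \<lambda>l\<in>{1..n}. U l \<omega>))
      borel ((\<lambda>f. indicator {j} (f (Suc n))) \<circ> (\<lambda>\<omega>. \<lambda>l\<in>{Suc n}. U l \<omega>))"
    by (rule indep_var_compose[OF indep_var_restrict[OF indep] h k]) auto
  also have "h \<circ> (\<lambda>\<omega>. \<lambda>l\<in>{1..n}. U l \<omega>) =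
      (\<lambda>\<omega>. sojourn_weight U x y n \<omega> * indicator F (walk U n \<omega>))"
    by (simp only: fun_eq_iff o_def h_def sojourn_weight_def walk_path[symmetric] sojourn_path[symmetric] simp_thms)
  also have "(\<lambda>f. indicator {j} (f (Suc n)) :: real) \<circ> (\<lambda>\<omega>. \<lambda>l\<in>{Suc n}. U l \<omega>) =
      (\<lambda>\<omega>. indicator {j} (U (Suc n) \<omega>))"
    by (simp add: fun_eq_iff)
  finally have ind: "indep_var borel (\<lambda>\<omega>. sojourn_weight U x y n \<omega> * indicator F (walk U n \<omega>))
      borel (\<lambda>\<omega>. indicator {j} (U (Suc n) \<omega>) :: real)" .
  have int: "integrable M (\<lambda>\<omega>. indicator {j} (U (Suc n) \<omega>) :: real)"
    by (rule integrable_const_bound[where B = 1]) (auto simp: indicator_def)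
  have "expectation (\<lambda>\<omega>. indicator {j} (U (Suc n) \<omega>) :: real) =
      expectation (indicator {\<omega> \<in> space M. U (Suc n) \<omega> = j})"
    by (intro Bochner_Integration.integral_cong) (auto simp: indicator_def)
  also have "\<dots> = prob {\<omega> \<in> space M. U (Suc n) \<omega> = j}" by simp
  finally show ?thesis
    using indep_var_lebesgue_integral[OF ind integrable_weighted_walk int] by (simp add: W_def)
qed

text \<open>
  The weight of the step into \<open>F\<close> is deterministic as long as it is constant on \<open>F\<close>; the previous
  position then lies in the translate of \<open>F\<close> by the opposite of the last step.
\<close>

lemma W_Suc:
  assumes "\<And>k. k \<in> F \<Longrightarrow> site_weight x y k = c"
  shows "W (Suc n) F = c * (p * W n {k. k + 1 \<in> F} + r * W n F + q * W n {k. k - 1 \<in> F})"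
proof -
  have [measurable]: "U (Suc n) \<in> measurable M (count_space UNIV)" by (simp add: measurable_step)
  let ?T = "\<lambda>j \<omega>. sojourn_weight U x y n \<omega> * indicator {k. k + j \<in> F} (walk U n \<omega>) *
    indicator {j} (U (Suc n) \<omega>) :: real"
  have int: "integrable M (?T j)" for j
    by (intro integrable_weighted) (auto simp: indicator_def)
  have meas: "(\<lambda>\<omega>. sojourn_weight U x y (Suc n) \<omega> * indicator F (walk U (Suc n) \<omega>)) \<in> borel_measurable M"
    using measurable_step by (intro measurable_weighted_walk) auto
  have "W (Suc n) F = expectation (\<lambda>\<omega>. c * (?T 1 \<omega> + ?T 0 \<omega> + ?T (-1) \<omega>))"
    unfolding W_def
  proof (rule integral_cong_AE)
    show "(\<lambda>\<omega>. c * (?T 1 \<omega> + ?T 0 \<omega> + ?T (-1) \<omega>)) \<in> borel_measurable M"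
      by (intro borel_measurable_times borel_measurable_add borel_measurable_const
            borel_measurable_integrable[OF int])
    show "AE \<omega> in M. sojourn_weight U x y (Suc n) \<omega> * indicator F (walk U (Suc n) \<omega>) =
        c * (?T 1 \<omega> + ?T 0 \<omega> + ?T (-1) \<omega>)"
      using AE_step[of n]
    proof eventually_elim
      case (elim \<omega>)
      have "sojourn_weight U x y (Suc n) \<omega> * indicator F (walk U (Suc n) \<omega>) =
          c * (sojourn_weight U x y n \<omega> * indicator F (walk U (Suc n) \<omega>))"
        using assms by (simp add: sojourn_weight_Suc indicator_def)
      then show ?case using elim by (auto simp: walk_Suc indicator_def)
    qed
  qed (rule meas)
  also have "\<dots> = c * (expectation (?T 1) + expectation (?T 0) + expectation (?T (-1)))"
    by (simp only: integral_mult_right_zero Bochner_Integration.integral_add int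
          Bochner_Integration.integrable_add)
  finally show ?thesis
    unfolding expectation_times_step
    using prob_down[of "Suc n"] prob_stay[of "Suc n"] prob_up[of "Suc n"]
    by (simp add: algebra_simps)
qed

lemma summable_W: "summable (\<lambda>n. W n F)"
proof (rule summable_comparison_test')
  show "summable (\<lambda>n. max x y ^ n)" using x y by (intro summable_geometric) auto
qed (use W_nonneg W_le in auto)

lemma G_Un: "A \<inter> B = {} \<Longrightarrow> G (A \<union> B) = G A + G B"
  by (simp add: G_def W_Un suminf_add summable_W)

lemma G_nonneg: "0 \<le> G F"
  by (simp add: G_def suminf_nonneg summable_W W_nonneg)

lemma G_le: "G F \<le> G UNIV"
  unfolding G_def by (intro suminf_le W_mono summable_W) auto

lemma G_rec:
  assumes "\<And>k. k \<in> F \<Longrightarrow> site_weight x y k = c"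
  shows "G F = indicator F 0 + c * (p * G {k. k + 1 \<in> F} + r * G F + q * G {k. k - 1 \<in> F})"
proof -
  have step: "W (Suc n) F = c * (p * W n {k. k + 1 \<in> F} + r * W n F + q * W n {k. k - 1 \<in> F})" for n
    using assms by (rule W_Suc)
  have "G F = W 0 F + (\<Sum>n. W (Suc n) F)"
    using suminf_split_head[OF summable_W, of F] by (simp add: G_def)
  also have "(\<Sum>n. W (Suc n) F) =
      c * (p * G {k. k + 1 \<in> F} + r * G F + q * G {k. k - 1 \<in> F})"
    unfolding step G_def
    by (intro sums_unique[symmetric] sums_mult sums_add summable_sums summable_W)
  finally show ?thesis unfolding W_0 .
qed

text \<open>
  Distributing the expectation \<open>W n F\<close> over the possible sojourn times gives the \<open>n\<close>-th block of the
  double series.  As the terms are nonnegative and the block sums are summable, the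
  unordered sum may be evaluated block by block.
\<close>

lemma K0_eq_G: "K0 M U F x y = G F"
proof -
  define f where "f = (\<lambda>(m, n). prob {\<omega> \<in> space M. sojourn U n \<omega> = m \<and> walk U n \<omega> \<in> F} * x ^ m * y ^ (n - m))"
  have W: "W n F = (\<Sum>m\<le>n. f (m, n))" for n
  proof -
    have [measurable]: "walk U n \<in> measurable M (count_space UNIV)" "sojourn U n \<in> measurable M (count_space UNIV)"
      by (auto intro!: measurable_walk measurable_sojourn measurable_step)
    let ?A = "\<lambda>m. {\<omega> \<in> space M. sojourn U n \<omega> = m \<and> walk U n \<omega> \<in> F}"
    have "W n F = expectation (\<lambda>\<omega>. \<Sum>m\<le>n. indicator (?A m) \<omega> * (x ^ m * y ^ (n - m)))"
      unfolding W_def sojourn_weight_expand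
      by (intro Bochner_Integration.integral_cong sum.cong) (auto simp: indicator_def)
    also have "\<dots> = (\<Sum>m\<le>n. f (m, n))"
      by (subst Bochner_Integration.integral_sum) (auto simp: f_def mult.assoc emeasure_eq_measure)
    finally show ?thesis .
  qed
  have f0: "0 \<le> f z" for z using x y by (auto simp: f_def case_prod_unfold)
  have inner: "((\<lambda>m. (\<lambda>(n, m). f (m, n)) (n, m)) has_sum W n F) {..n}" for n
    by (simp add: W has_sum_finite)
  have outer: "((\<lambda>n. W n F) has_sum G F) UNIV"
    unfolding G_def by (intro sums_nonneg_imp_has_sum summable_sums summable_W W_nonneg)
  have "((\<lambda>(n, m). f (m, n)) has_sum G F) (SIGMA n:UNIV. {..n})"
    using inner outer f0
    by (intro has_sum_SigmaI[where g = "\<lambda>n. W n F"] summable_on_SigmaI[where g = "\<lambda>n. W n F"])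
       (auto simp: summable_on_def)
  moreover have "bij_betw (\<lambda>(n, m). (m, n)) (SIGMA n:UNIV. {..n}) {(m, n). m \<le> (n::nat)}"
    by (rule bij_betwI[of _ _ _ "\<lambda>(m, n). (n, m)"]) auto
  ultimately have "(f has_sum G F) {(m, n). m \<le> n}"
    by (subst has_sum_reindex_bij_betw[symmetric]) (auto simp: case_prod_unfold)
  then show ?thesis unfolding K0_def f_def by (rule infsumI)
qed

section \<open>Evaluating the Green measure\<close>

lemma G_singleton:
  "G {k} = indicator {k} 0 + site_weight x y k * (p * G {k - 1} + r * G {k} + q * G {k + 1})"
proof -
  have "{j. j + 1 \<in> {k}} = {k - 1}" "{j. j - 1 \<in> {k}} = {k + 1}" by auto
  then show ?thesis using G_rec[of "{k}" "site_weight x y k"] by simp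
qed

lemma G_bound: "\<bar>G F\<bar> \<le> G UNIV"
  using G_nonneg[of F] G_le[of F] by simp

lemma G_right: "2 * x * q * G {1} = (1 - r * x - sqrt (Delta p q r x)) * G {0}"
proof -
  have "(1 - r * x) * G {int (Suc k)} = x * (p * G {int k} + q * G {int (Suc (Suc k))})" for k
    using G_singleton[of "int (Suc k)"] by (simp add: site_weight_def algebra_simps)
  from bounded_solution_first_step[where g = "\<lambda>k. G {int k}", OF _ _ _ _ _ _ G_bound this]
  show ?thesis using pqr_nonneg total x by simp
qed

text \<open>
  Reflection at the origin turns the negative half line into the positive one and interchanges
  \<open>p\<close> and \<open>q\<close>, which leaves \<open>Delta\<close> unchanged.
\<close>

lemma G_left: "2 * y * p * G {-1} = (1 - r * y - sqrt (Delta p q r y)) * G {0}"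
proof -
  have "(1 - r * y) * G {- int (Suc k)} = y * (q * G {- int k} + p * G {- int (Suc (Suc k))})" for k
    using G_singleton[of "- int (Suc k)"] by (simp add: site_weight_def algebra_simps)
  from bounded_solution_first_step[where g = "\<lambda>k. G {- int k}", OF _ _ _ _ _ _ G_bound this]
  show ?thesis using pqr_nonneg total y by (simp add: Delta_def mult_ac add_ac)
qed

lemma G_zero:
  "G {0} * (y - x + y * sqrt (Delta p q r x) + x * sqrt (Delta p q r y)) = 2 * y"
proof -
  have "G {0} = 1 + x * (p * G {-1} + r * G {0} + q * G {1})"
    using G_singleton[of 0] by (simp add: site_weight_def)
  then have "2 * y * G {0} = 2 * y * (1 + x * (p * G {-1} + r * G {0} + q * G {1}))"
    by (rule arg_cong)
  also have "\<dots> = 2 * y + x * (2 * y * p * G {-1}) + 2 * x * y * r * G {0} + y * (2 * x * q * G {1})"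
    by (simp add: algebra_simps)
  finally show ?thesis unfolding G_left G_right by (simp add: algebra_simps)
qed

text \<open>
  For the nonnegative half line, the mass balance: a step enters it from \<open>-1\<close> and leaves it
  from \<open>0\<close>.  The other half line gains and loses the same flow, with the weight \<open>y\<close> instead of \<open>x\<close>.
\<close>

lemma G_nonneg_half_line: "(1 - x) * G {0..} = 1 + x * p * G {-1} - x * q * G {0}"
proof -
  have rec: "G {0..} = 1 + x * (p * G {-1..} + r * G {0..} + q * G {1..})"
  proof -
    have "{k::int. k + 1 \<in> {0..}} = {-1..}" "{k::int. k - 1 \<in> {0..}} = {1..}" by auto
    then show ?thesis using G_rec[of "{0..}" x] by (simp add: site_weight_def)
  qed
  have "{-1::int..} = {-1} \<union> {0..}" by auto
  then have 1: "G {-1..} = G {-1} + G {0..}" by (simp add: G_Un del: Un_insert_left)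
  have "{0::int..} = {0} \<union> {1..}" by auto
  then have "G {0..} = G {0} + G {1..}" by (simp add: G_Un del: Un_insert_left)
  then have 2: "G {1..} = G {0..} - G {0}" by simp
  have "G {0..} = 1 + x * p * G {-1} - x * q * G {0} + x * (p + q + r) * G {0..}"
    using rec unfolding 1 2 by (simp add: algebra_simps)
  then show ?thesis unfolding total by (simp add: algebra_simps)
qed

lemma G_neg_half_line: "(1 - y) * G {..<0} = y * q * G {0} - y * p * G {-1}"
proof -
  have rec: "G {..<0} = y * (p * G {..<-1} + r * G {..<0} + q * G {..<1})"
  proof -
    have "{k::int. k + 1 \<in> {..<0}} = {..<-1}" "{k::int. k - 1 \<in> {..<0}} = {..<1}" by auto
    then show ?thesis using G_rec[of "{..<0}" y] by (simp add: site_weight_def)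
  qed
  have "{..<0::int} = {-1} \<union> {..<-1}" by auto
  then have "G {..<0} = G {-1} + G {..<-1}" by (simp add: G_Un del: Un_insert_left)
  then have 1: "G {..<-1} = G {..<0} - G {-1}" by simp
  have "{..<1::int} = {0} \<union> {..<0}" by auto
  then have 2: "G {..<1} = G {0} + G {..<0}" by (simp add: G_Un del: Un_insert_left)
  have "G {..<0} = y * q * G {0} - y * p * G {-1} + y * (p + q + r) * G {..<0}"
    using rec unfolding 1 2 by (simp add: algebra_simps)
  then show ?thesis unfolding total by (simp add: algebra_simps)
qed

text \<open>
  The factor \<open>2 y\<close> is there so that \<open>2 y p G{-1}\<close> can be replaced by means of the square root at
  \<open>y\<close>, and the inhomogeneous term \<open>2 y\<close> by the equation for \<open>G{0}\<close>; everything is then a multiple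
  of \<open>G{0}\<close>, and no division by \<open>p\<close> occurs.
\<close>

lemma G_UNIV:
  "2 * y * ((1 - x) * (1 - y) * G UNIV) = y * G {0} *
     ((p - q) * (x - y) + (1 - y) * sqrt (Delta p q r x) + (1 - x) * sqrt (Delta p q r y))"
proof -
  have r: "r = 1 - p - q" using total by simp
  define sx where "sx = sqrt (Delta p q r x)"
  define sy where "sy = sqrt (Delta p q r y)"
  have zero: "(1 - y) * (2 * y) = (1 - y) * (G {0} * (y - x + y * sx + x * sy))"
    using G_zero by (simp add: sx_def sy_def)
  have "(UNIV :: int set) = {0..} \<union> {..<0}" "{0::int..} \<inter> {..<0} = {}" by auto
  then have "G UNIV = G {0..} + G {..<0}"  by (metis G_Un)
  then have "2 * y * ((1 - x) * (1 - y) * G UNIV) =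
      2 * y * (1 - y) * ((1 - x) * G {0..}) + 2 * y * (1 - x) * ((1 - y) * G {..<0})"
    by (simp add: algebra_simps)
  also have "\<dots> = (1 - y) * (2 * y) + (1 - y) * (x * (2 * y * p * G {-1}) - 2 * x * y * q * G {0}) +
      (1 - x) * y * (2 * y * q * G {0} - 2 * y * p * G {-1})"
    unfolding G_nonneg_half_line G_neg_half_line by (simp add: algebra_simps)
  also have "\<dots> = G {0} * ((1 - y) * (y - x + y * sx + x * sy + x * (1 - r * y - sy) - 2 * x * y * q) +
      (1 - x) * y * (2 * y * q - (1 - r * y - sy)))"
    unfolding G_left sx_def[symmetric] sy_def[symmetric] zero by (simp add: algebra_simps)
  also have "(1 - y) * (y - x + y * sx + x * sy + x * (1 - r * y - sy) - 2 * x * y * q) +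
      (1 - x) * y * (2 * y * q - (1 - r * y - sy)) =
      y * ((p - q) * (x - y) + (1 - y) * sx + (1 - x) * sy)"
    unfolding r by (simp add: algebra_simps)
  finally show ?thesis by (simp add: sx_def sy_def)
qed

end

section \<open>The generating function\<close>

theorem theorem5p1:
  fixes M :: "'a measure" and U :: "nat \<Rightarrow> 'a \<Rightarrow> int" and p q r x y :: real
  assumes "prob_space M"
    and "prob_space.indep_vars M (\<lambda>_. count_space UNIV) U {1..}"
    and "\<And>l. l \<ge> 1 \<Longrightarrow> distr M (count_space UNIV) (U l) = distr M (count_space UNIV) (U 1)"
    and "measure M {\<omega> \<in> space M. U 1 \<omega> = -1} = q"
    and "measure M {\<omega> \<in> space M. U 1 \<omega> = 0} = r"
    and "measure M {\<omega> \<in> space M. U 1 \<omega> = 1} = p"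
    and "p + q + r = 1"
    and "x \<in> {0<..<1}" and "y \<in> {0<..<1}"
  shows "K0 M U UNIV x y =
           y * (((p - q) * (x - y) + (1 - y) * sqrt (Delta p q r x) + (1 - x) * sqrt (Delta p q r y)) /
             ((1 - x) * (1 - y) * (y - x + y * sqrt (Delta p q r x) + x * sqrt (Delta p q r y))))
       \<and> K0 M U {0} x y =
           2 * y / (y - x + y * sqrt (Delta p q r x) + x * sqrt (Delta p q r y))"
proof -
  interpret prob_space M by fact
  have meas: "U l \<in> measurable M (count_space UNIV)" if "l \<ge> 1" for l
    using assms(2) that by (auto simp: indep_vars_def)
  have same: "prob {\<omega> \<in> space M. U l \<omega> = j} = prob {\<omega> \<in> space M. U 1 \<omega> = j}" if "l \<ge> 1" for l j
  proof -
    have "prob {\<omega> \<in> space M. U i \<omega> = j} = measure (distr M (count_space UNIV) (U i)) {j}"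
      if "i \<ge> 1" for i
      using meas[OF that] by (subst measure_distr) (auto intro!: arg_cong[where f = prob])
    then show ?thesis using assms(3)[OF that] that by simp
  qed
  interpret nearest_neighbour_walk M U p q r x y
  proof unfold_locales
    fix l :: nat assume l: "l \<ge> 1"
    show "prob {\<omega> \<in> space M. U l \<omega> = -1} = q" using same[OF l] assms(4) by (rule trans)
    show "prob {\<omega> \<in> space M. U l \<omega> = 0} = r" using same[OF l] assms(5) by (rule trans)
    show "prob {\<omega> \<in> space M. U l \<omega> = 1} = p" using same[OF l] assms(6) by (rule trans)
  qed (use assms(2,7-9) in auto)
  define D where "D = y - x + y * sqrt (Delta p q r x) + x * sqrt (Delta p q r y)"
  define N where "N = (p - q) * (x - y) + (1 - y) * sqrt (Delta p q r x) + (1 - x) * sqrt (Delta p q r y)"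
  have "G {0} * D = 2 * y" using G_zero by (simp add: D_def)
  moreover from this have "D \<noteq> 0" using y by auto
  ultimately have G0: "G {0} = 2 * y / D" by (simp add: nonzero_eq_divide_eq)
  have "2 * y * ((1 - x) * (1 - y) * G UNIV) = 2 * y * (y * (N / D))"
    using G_UNIV by (simp add: N_def G0)
  then have "(1 - x) * (1 - y) * G UNIV = y * (N / D)"
    using y by (subst (asm) mult_left_cancel) simp_all
  moreover have "(1 - x) * (1 - y) \<noteq> 0" using x y by simp
  ultimately have "G UNIV = y * (N / D) / ((1 - x) * (1 - y))"
    by (metis nonzero_mult_div_cancel_left)
  then have "G UNIV = y * (N / ((1 - x) * (1 - y) * D))" by (simp add: mult_ac)
  then show ?thesis using G0 by (simp add: K0_eq_G N_def D_def)
qed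

end
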